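(* Let $f_1,\dots,f_n:\mathbb{R}^d\to\mathbb{R}$ be convex, with each $f_i$ $L_i$-smooth ($L_i>0$), let $g:\mathbb{R}^d\to\mathbb{R}$ be $\mu$-strongly convex ($\mu>0$, possibly non-smooth), let $F=\frac1n\sum_{i=1}^n f_i+g$ and let $x^\star$ be a minimizer of $F$. Let $0<\eta<1/\widetilde L$ and let the momentum parameter $\omega$ satisfy $0<\omega\le 1-\frac{\widetilde L\eta}{1-\widetilde L\eta}$. Suppose that the epoch length $m$ is sufficiently large so that $$\rho:=1-\omega+\frac{\omega^2}{m\mu\eta}<1 .$$ Then the snapshots $\widetilde x^s$ produced by ASVRG for strongly convex objectives with Option I (described in the context) satisfy, for all $s=1,\dots,S$, $$\mathbb{E}\left[F(\widetilde x^{s})-F(x^\star)\right]\le \rho^{s}\left[F(\widetilde x^{0})-F(x^\star)\right].$$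
   Context: $L_i$-smooth means differentiable with $\|\nabla f_i(x)-\nabla f_i(y)\|\le L_i\|x-y\|$ for all $x,y$. $g$ is $\mu$-strongly convex if $g(y)\ge g(x)+\xi^T(y-x)+\frac{\mu}{2}\|x-y\|^2$ for all $x,y$ and all $\xi\in\partial g(x)$. $\|\cdot\|$ is the Euclidean norm. $P=(p_1,\dots,p_n)$ is a probability vector with all $p_i>0$, $f=\frac1n\sum_i f_i$, and $\widetilde L:=\max_j L_j/(np_j)$. ASVRG for strongly convex objectives, Option I, with step size $\eta>0$, momentum parameter $\omega$, epoch length $m\ge 1$, number of epochs $S$, deterministic starting point $\widetilde x^0$: for $s=1,\dots,S$, set $x_0^s=y_0^s=\widetilde x^{s-1}$; for $t=1,\dots,m$, draw $i_t\in\{1,\dots,n\}$ according to $P$, independently of everything before, and set $$\widetilde\nabla f_{i_t}(x^s_{t-1})=\frac{\nabla f_{i_t}(x^s_{t-1})-\nabla f_{i_t}(\widetilde x^{s-1})}{np_{i_t}}+\nabla f(\widetilde x^{s-1}),$$ $$y_t^s=\arg\min_{y\in\mathbb{R}^d}\Big\{\langle\widetilde\nabla f_{i_t}(x^s_{t-1}),y-y^s_{t-1}\rangle+\frac{\omega}{2\eta}\|y-y^s_{t-1}\|^2+g(y)\Big\},\qquad x_t^s=\widetilde x^{s-1}+\omega(y_t^s-\widetilde x^{s-1});$$ finally $\widetilde x^s=\frac1m\sum_{t=1}^m x_t^s$. Expectations are over all random indices. *)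

theory Defs
  imports "HOL-Probability.Probability"
begin

definition gradient :: "('a::real_inner \<Rightarrow> real) \<Rightarrow> 'a \<Rightarrow> 'a" where
  "gradient f x = (THE D. GDERIV f x :> D)"

definition L_smooth :: "real \<Rightarrow> ('a::real_inner \<Rightarrow> real) \<Rightarrow> bool" where
  "L_smooth L f \<longleftrightarrow>
     (\<forall>x. f differentiable (at x)) \<and>
     (\<forall>x y. norm (gradient f x - gradient f y) \<le> L * norm (x - y))"

definition subdifferential :: "('a::real_inner \<Rightarrow> real) \<Rightarrow> 'a \<Rightarrow> 'a set" where
  "subdifferential g x = {\<xi>. \<forall>y. g y \<ge> g x + \<xi> \<bullet> (y - x)}"

(* Convexity is required explicitly: for a non-convex function the inequality below
   would be vacuous at all points with empty subdifferential. *)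
definition strongly_convex :: "real \<Rightarrow> ('a::real_inner \<Rightarrow> real) \<Rightarrow> bool" where
  "strongly_convex \<mu> g \<longleftrightarrow>
     convex_on UNIV g \<and>
     (\<forall>x y. \<forall>\<xi>\<in>subdifferential g x.
        g y \<ge> g x + \<xi> \<bullet> (y - x) + \<mu> / 2 * (norm (x - y))\<^sup>2)"

definition average :: "nat \<Rightarrow> (nat \<Rightarrow> 'a \<Rightarrow> real) \<Rightarrow> 'a \<Rightarrow> real" where
  "average n f x = (1 / real n) * (\<Sum>i=1..n. f i x)"

definition L_tilde :: "nat \<Rightarrow> (nat \<Rightarrow> real) \<Rightarrow> (nat \<Rightarrow> real) \<Rightarrow> real" where
  "L_tilde n p L = Max ((\<lambda>j. L j / (real n * p j)) ` {1..n})"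

definition svrg_gradient ::
  "nat \<Rightarrow> (nat \<Rightarrow> real) \<Rightarrow> (nat \<Rightarrow> 'a::real_inner \<Rightarrow> real) \<Rightarrow> 'a \<Rightarrow> nat \<Rightarrow> 'a \<Rightarrow> 'a" where
  "svrg_gradient n p f z i x =
     (1 / (real n * p i)) *\<^sub>R (gradient (f i) x - gradient (f i) z) + gradient (average n f) z"

definition prox_step ::
  "('a::real_inner \<Rightarrow> real) \<Rightarrow> real \<Rightarrow> real \<Rightarrow> 'a \<Rightarrow> 'a \<Rightarrow> 'a" where
  "prox_step g \<eta> \<omega> v y' =
     arg_min (\<lambda>y. v \<bullet> (y - y') + \<omega> / (2 * \<eta>) * (norm (y - y'))\<^sup>2 + g y) (\<lambda>_. True)"

(* One epoch with snapshot z and index sequence i 1, i 2, ...; the value at t is the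
   pair (x_t, y_t). *)
primrec asvrg_epoch ::
  "nat \<Rightarrow> (nat \<Rightarrow> real) \<Rightarrow> (nat \<Rightarrow> 'a::real_inner \<Rightarrow> real) \<Rightarrow> ('a \<Rightarrow> real) \<Rightarrow> real \<Rightarrow> real \<Rightarrow>
   'a \<Rightarrow> (nat \<Rightarrow> nat) \<Rightarrow> nat \<Rightarrow> 'a \<times> 'a" where
  "asvrg_epoch n p f g \<eta> \<omega> z i 0 = (z, z)"
| "asvrg_epoch n p f g \<eta> \<omega> z i (Suc t) =
     (let (x, y) = asvrg_epoch n p f g \<eta> \<omega> z i t;
          y' = prox_step g \<eta> \<omega> (svrg_gradient n p f z (i (Suc t)) x) y
      in (z + \<omega> *\<^sub>R (y' - z), y'))"

(* Snapshot after s epochs along the index path i, where i s t is the index used in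
   inner iteration t of epoch s (both counted from 1). *)
primrec asvrg_snapshot ::
  "nat \<Rightarrow> (nat \<Rightarrow> real) \<Rightarrow> (nat \<Rightarrow> 'a::real_inner \<Rightarrow> real) \<Rightarrow> ('a \<Rightarrow> real) \<Rightarrow> real \<Rightarrow> real \<Rightarrow>
   nat \<Rightarrow> 'a \<Rightarrow> (nat \<Rightarrow> nat \<Rightarrow> nat) \<Rightarrow> nat \<Rightarrow> 'a" where
  "asvrg_snapshot n p f g \<eta> \<omega> m x0 i 0 = x0"
| "asvrg_snapshot n p f g \<eta> \<omega> m x0 i (Suc s) =
     (1 / real m) *\<^sub>R
     (\<Sum>t=1..m. fst (asvrg_epoch n p f g \<eta> \<omega> (asvrg_snapshot n p f g \<eta> \<omega> m x0 i s) (i (Suc s)) t))"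

(* The indices of the first S epochs are i.i.d. with P(idx s t = i) = p i.  Mutual
   independence over all (s, t) says that each draw is independent of all earlier ones. *)
definition iid_indices ::
  "'w measure \<Rightarrow> nat \<Rightarrow> (nat \<Rightarrow> real) \<Rightarrow> nat \<Rightarrow> nat \<Rightarrow> (nat \<Rightarrow> nat \<Rightarrow> 'w \<Rightarrow> nat) \<Rightarrow> bool" where
  "iid_indices M n p S m idx \<longleftrightarrow>
     prob_space.indep_vars M (\<lambda>_. count_space {1..n}) (\<lambda>(s, t). idx s t) ({1..S} \<times> {1..m}) \<and>
     (\<forall>s\<in>{1..S}. \<forall>t\<in>{1..m}. \<forall>i\<in>{1..n}. measure M {w \<in> space M. idx s t w = i} = p i)"

end

theory Submission
  imports Defs
begin

text \<open>
  Fix an inner iteration with snapshot \<open>z\<close>, point \<open>x = (1 - \<omega>) z + \<omega> y\<close> and its random successor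
  \<open>x' = (1 - \<omega>) z + \<omega> y'\<close>. The three-point inequality of the proximal step, smoothness of the mean
  and the variance bound
  \<open>E |v - \<nabla>f(x)|\<^sup>2 \<le> 2 L_tilde (f(z) - f(x) - \<nabla>f(x) \<bullet> (z - x))\<close> combine to
  \<open>E [F(x') - F*] + \<omega>\<^sup>2/(2\<eta>) E |x* - y'|\<^sup>2 \<le> (1 - \<omega>) (F(z) - F*) + \<omega>\<^sup>2/(2\<eta>) |x* - y|\<^sup>2\<close>.
  Summing over the epoch telescopes the distances, and
  \<open>\<mu>/2 |x* - z|\<^sup>2 \<le> F(z) - F*\<close> turns the initial distance into a function gap.
\<close>

subsection \<open>Gradients and convexity\<close>

text \<open>The update of x is a scaled copy of the update of y: x' - x = \<omega> (y' - y).
  Multiplied by \<omega>, the proximal inequality therefore offers 1/(2\<eta>) |x' - x|^2 to pay for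
  smoothness and noise, and carries the weight \<omega>^2/(2\<eta>) on the distances. Averaging over
  m iterations turns this weight, times 2/\<mu>, into the second part of \<rho>. Two obstacles shape
  the rest. The gradient, the proximal point and strong convexity are given by descriptions that say
  something only if a Riesz vector, a minimizer or a subgradient exists, so existence comes first.
  And measurability of iterates built from \<open>arg_min\<close> is not evident; but each iterate
  depends on finitely many indices from a finite set, so every real function of it is measurable and
  bounded, and conditioning on the past becomes a finite sum over the next index.\<close>

lemma has_derivative_gradient:
  fixes f :: "'a::euclidean_space \<Rightarrow> real"
  assumes "f differentiable (at x)"
  shows "(f has_derivative (\<lambda>h. gradient f x \<bullet> h)) (at x)"
proof -
  obtain f' where f': "(f has_derivative f') (at x)"
    using assms unfolding differentiable_def by blast
  interpret bounded_linear f' using f' by (rule has_derivative_bounded_linear)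
  \<comment> \<open>The Riesz representative of the derivative; with its uniqueness the definite
    description in \<open>gradient\<close> denotes it.\<close>
  define D where "D = (\<Sum>b\<in>Basis. f' b *\<^sub>R b)"
  have "f' h = h \<bullet> D" for h
  proof -
    have "f' h = f' (\<Sum>b\<in>Basis. (h \<bullet> b) *\<^sub>R b)" by (simp add: euclidean_representation)
    also have "\<dots> = (\<Sum>b\<in>Basis. (h \<bullet> b) * f' b)" by (simp add: sum scaleR)
    also have "\<dots> = h \<bullet> D" by (simp add: D_def inner_sum_right mult.commute)
    finally show ?thesis .
  qed
  then have "f' = (\<lambda>h. h \<bullet> D)" by (rule ext)
  with f' have D: "GDERIV f x :> D" by (simp add: gderiv_def)
  have "D' = D" if "GDERIV f x :> D'" for D'
  proof -
    have "(\<lambda>h. h \<bullet> D') = (\<lambda>h. h \<bullet> D)"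
      using that D unfolding gderiv_def by (rule has_derivative_unique)
    then have "\<forall>h. h \<bullet> D' = h \<bullet> D" by (simp add: fun_eq_iff)
    then show ?thesis by (simp only: vector_eq_ldot)
  qed
  with D have "gradient f x = D" unfolding gradient_def by blast
  with D show ?thesis by (simp add: gderiv_def inner_commute)
qed

lemma gradient_eqI:
  fixes f :: "'a::euclidean_space \<Rightarrow> real"
  assumes "(f has_derivative (\<lambda>h. D \<bullet> h)) (at x)"
  shows "gradient f x = D"
proof -
  have "f differentiable (at x)" using assms by (auto simp: differentiable_def)
  from has_derivative_unique[OF has_derivative_gradient[OF this] assms]
  have "\<forall>h. gradient f x \<bullet> h = D \<bullet> h" by (simp add: fun_eq_iff)
  then show ?thesis by (simp only: vector_eq_rdot)
qed

lemma gradient_average: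
  fixes f :: "nat \<Rightarrow> 'a::euclidean_space \<Rightarrow> real"
  assumes "\<And>i. i \<in> {1..n} \<Longrightarrow> f i differentiable (at x)"
  shows "gradient (average n f) x = (1 / real n) *\<^sub>R (\<Sum>i=1..n. gradient (f i) x)"
proof (rule gradient_eqI)
  have "((\<lambda>x. (1 / real n) * (\<Sum>i=1..n. f i x)) has_derivative
      (\<lambda>h. (1 / real n) * (\<Sum>i=1..n. gradient (f i) x \<bullet> h))) (at x)"
    by (intro has_derivative_mult_right has_derivative_sum has_derivative_gradient assms)
  then show "(average n f has_derivative
      (\<lambda>h. ((1 / real n) *\<^sub>R (\<Sum>i=1..n. gradient (f i) x)) \<bullet> h)) (at x)"
    unfolding average_def[abs_def] by (simp add: inner_sum_left)
qed

lemma has_real_derivative_along_line: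
  fixes f :: "'a::euclidean_space \<Rightarrow> real"
  assumes "f differentiable (at (x + t *\<^sub>R d))"
  shows "((\<lambda>t. f (x + t *\<^sub>R d)) has_real_derivative gradient f (x + t *\<^sub>R d) \<bullet> d) (at t)"
proof -
  have "((\<lambda>t. x + t *\<^sub>R d) has_derivative (\<lambda>h. h *\<^sub>R d)) (at t)"
    by (auto intro!: derivative_eq_intros)
  from has_derivative_compose[OF this has_derivative_gradient[OF assms]]
  have "((\<lambda>t. f (x + t *\<^sub>R d)) has_derivative (\<lambda>h. gradient f (x + t *\<^sub>R d) \<bullet> (h *\<^sub>R d))) (at t)" .
  moreover have "(\<lambda>h. gradient f (x + t *\<^sub>R d) \<bullet> (h *\<^sub>R d)) = (*) (gradient f (x + t *\<^sub>R d) \<bullet> d)"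
    by (simp add: fun_eq_iff mult.commute)
  ultimately show ?thesis by (simp only: has_field_derivative_def)
qed

text \<open>Restriction to the line through x and y reduces this to convex functions of one real
  variable.\<close>

lemma convex_above_tangent:
  fixes f :: "'a::euclidean_space \<Rightarrow> real"
  assumes "convex_on UNIV f" "f differentiable (at x)"
  shows "f x + gradient f x \<bullet> (y - x) \<le> f y"
proof -
  have "convex_on UNIV (\<lambda>t::real. f (x + t *\<^sub>R (y - x)))"
  proof (rule convex_onI)
    fix t a b :: real assume t: "0 < t" "t < 1"
    have "x + ((1 - t) *\<^sub>R a + t *\<^sub>R b) *\<^sub>R (y - x)
        = (1 - t) *\<^sub>R (x + a *\<^sub>R (y - x)) + t *\<^sub>R (x + b *\<^sub>R (y - x))"
      by (simp add: algebra_simps)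
    then show "f (x + ((1 - t) *\<^sub>R a + t *\<^sub>R b) *\<^sub>R (y - x))
        \<le> (1 - t) * f (x + a *\<^sub>R (y - x)) + t * f (x + b *\<^sub>R (y - x))"
      using convex_onD[OF assms(1), of t "x + a *\<^sub>R (y - x)" "x + b *\<^sub>R (y - x)"] t by simp
  qed simp
  moreover have "((\<lambda>t. f (x + t *\<^sub>R (y - x))) has_real_derivative gradient f x \<bullet> (y - x)) (at 0)"
    using has_real_derivative_along_line[of f x 0 "y - x"] assms(2) by simp
  ultimately have "f (x + 1 *\<^sub>R (y - x)) - f (x + 0 *\<^sub>R (y - x)) \<ge> (gradient f x \<bullet> (y - x)) * (1 - 0)"
    by (intro convex_on_imp_above_tangent[where A = UNIV]) auto
  then show ?thesis by simp
qed

lemma smooth_descent: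
  fixes f :: "'a::euclidean_space \<Rightarrow> real"
  assumes "L_smooth L f"
  shows "f y \<le> f x + gradient f x \<bullet> (y - x) + L / 2 * (norm (y - x))\<^sup>2"
proof -
  define d where "d = y - x"
  \<comment> \<open>The gap between f and its quadratic upper model along the segment. Lipschitz
    continuity of the gradient makes it nonincreasing, which replaces integrating the
    gradient.\<close>
  define h where "h = (\<lambda>t. f (x + t *\<^sub>R d) - t * (gradient f x \<bullet> d) - L / 2 * t\<^sup>2 * (norm d)\<^sup>2)"
  have "h 1 \<le> h 0"
  proof (rule DERIV_nonpos_imp_nonincreasing[where f = h and a = 0 and b = 1])
    fix t :: real assume t: "0 \<le> t" "t \<le> 1"
    have "((\<lambda>t. f (x + t *\<^sub>R d)) has_real_derivative gradient f (x + t *\<^sub>R d) \<bullet> d) (at t)"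
      by (rule has_real_derivative_along_line) (use assms in \<open>simp add: L_smooth_def\<close>)
    moreover have "((\<lambda>t. t * (gradient f x \<bullet> d)) has_real_derivative gradient f x \<bullet> d) (at t)"
      by (auto intro!: derivative_eq_intros)
    moreover have "((\<lambda>t. L / 2 * t\<^sup>2 * (norm d)\<^sup>2) has_real_derivative L * t * (norm d)\<^sup>2) (at t)"
      by (auto intro!: derivative_eq_intros)
    ultimately have "(h has_real_derivative
        (gradient f (x + t *\<^sub>R d) \<bullet> d - gradient f x \<bullet> d - L * t * (norm d)\<^sup>2)) (at t)"
      unfolding h_def by (intro DERIV_diff)
    moreover have "gradient f (x + t *\<^sub>R d) \<bullet> d - gradient f x \<bullet> d \<le> L * t * (norm d)\<^sup>2"
    proof -
      have "(gradient f (x + t *\<^sub>R d) - gradient f x) \<bullet> d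
          \<le> norm (gradient f (x + t *\<^sub>R d) - gradient f x) * norm d"
        by (rule norm_cauchy_schwarz)
      also have "\<dots> \<le> (L * norm (x + t *\<^sub>R d - x)) * norm d"
        using assms unfolding L_smooth_def by (meson mult_right_mono norm_ge_zero)
      also have "\<dots> = L * t * (norm d)\<^sup>2" using t by (simp add: power2_eq_square)
      finally show ?thesis by (simp add: inner_diff_left)
    qed
    ultimately show "\<exists>D. (h has_real_derivative D) (at t) \<and> D \<le> 0" by force
  qed simp
  then show ?thesis by (simp add: h_def d_def)
qed

text \<open>The function f - \<open>gradient f x\<close> \<bullet> (.) is minimal at x, by
  convexity. A gradient step of length 1/L from z lowers it by at least |r|^2/(2L), yet not below
  its value at x. The point \<open>u\<close> is the end of that step.\<close>

lemma smooth_convex_cocoercive: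
  fixes f :: "'a::euclidean_space \<Rightarrow> real"
  assumes "convex_on UNIV f" "L_smooth L f" "L > 0"
  shows "(norm (gradient f x - gradient f z))\<^sup>2 \<le> 2 * L * (f z - f x - gradient f x \<bullet> (z - x))"
proof -
  define r where "r = gradient f z - gradient f x"
  define u where "u = z - (1 / L) *\<^sub>R r"
  have 1: "f x + gradient f x \<bullet> (u - x) \<le> f u"
    using assms by (intro convex_above_tangent) (auto simp: L_smooth_def)
  have 2: "f u \<le> f z + gradient f z \<bullet> (u - z) + L / 2 * (norm (u - z))\<^sup>2"
    using assms(2) by (rule smooth_descent)
  have uz: "u - z = - ((1 / L) *\<^sub>R r)" by (simp add: u_def)
  have 3: "L / 2 * (norm (u - z))\<^sup>2 = (norm r)\<^sup>2 / (2 * L)"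
    using assms(3) unfolding uz by (simp add: power_mult_distrib power2_eq_square field_simps)
  have "gradient f z \<bullet> (u - z) - gradient f x \<bullet> (u - z) = r \<bullet> (u - z)"
    by (simp add: r_def inner_diff_left)
  also have "\<dots> = - ((norm r)\<^sup>2 / L)" unfolding uz by (simp add: power2_norm_eq_inner)
  finally have 4: "gradient f z \<bullet> (u - z) - gradient f x \<bullet> (u - z) = - ((norm r)\<^sup>2 / L)" .
  have "gradient f x \<bullet> (u - x) = gradient f x \<bullet> (u - z) + gradient f x \<bullet> (z - x)"
    by (simp add: inner_diff_right)
  with 1 2 3 4 have "(norm r)\<^sup>2 / L - (norm r)\<^sup>2 / (2 * L) \<le> f z - f x - gradient f x \<bullet> (z - x)"
    by linarith
  then have "(norm r)\<^sup>2 \<le> 2 * L * (f z - f x - gradient f x \<bullet> (z - x))"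
    using assms(3) by (simp add: field_simps)
  then show ?thesis by (simp add: r_def norm_minus_commute)
qed

text \<open>A subgradient is the normalised normal of a hyperplane that separates the point from the
  strict epigraph.\<close>
lemma subdifferential_nonempty:
  fixes g :: "'a::euclidean_space \<Rightarrow> real"
  assumes "convex_on UNIV g"
  shows "subdifferential g x \<noteq> {}"
proof -
  define T where "T = {p. g (fst p) < snd p}"
  have "convex T"
  proof (rule convexI)
    fix p q :: "'a \<times> real" and a b :: real
    assume p: "p \<in> T" and q: "q \<in> T" and ab: "0 \<le> a" "0 \<le> b" "a + b = 1"
    have "g (a *\<^sub>R fst p + b *\<^sub>R fst q) \<le> a * g (fst p) + b * g (fst q)"
      using assms ab by (auto simp: convex_on_def)
    also have "\<dots> < a * snd p + b * snd q"
    proof (cases "a = 0")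
      case False
      then have "a * g (fst p) < a * snd p" using ab p by (simp add: T_def)
      moreover have "b * g (fst q) \<le> b * snd q" using ab q by (intro mult_left_mono) (auto simp: T_def)
      ultimately show ?thesis by linarith
    qed (use ab q in \<open>simp add: T_def\<close>)
    finally show "a *\<^sub>R p + b *\<^sub>R q \<in> T" by (simp add: T_def)
  qed
  moreover have "(x, g x + 1) \<in> T" by (simp add: T_def)
  then have "T \<noteq> {}" by blast
  ultimately obtain c b where c: "c \<noteq> 0" "c \<bullet> (x, g x) \<le> b" "\<And>p. p \<in> T \<Longrightarrow> b \<le> c \<bullet> p"
    using separating_hyperplane_sets[of "{(x, g x)}" T] by (auto simp: T_def)
  obtain a \<alpha> where c_eq: "c = (a, \<alpha>)" by (cases c)
  have sep: "a \<bullet> x + \<alpha> * g x \<le> a \<bullet> y + \<alpha> * r" if "g y < r" for y r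
    using c(2) c(3)[of "(y, r)"] that by (simp add: T_def c_eq)
  have "0 \<le> \<alpha>" using sep[of x "g x + 1"] by (simp add: algebra_simps)
  \<comment> \<open>A vertical hyperplane would bound a \<bullet> x by a \<bullet> y for every y,
    because g is finite everywhere; y = x - a then forces a = 0.\<close>
  moreover have "\<alpha> \<noteq> 0"
  proof
    assume "\<alpha> = 0"
    then have "a \<bullet> x \<le> a \<bullet> (x - a)" using sep[of "x - a" "g (x - a) + 1"] by simp
    then have "a = 0" by (simp add: inner_diff_right) (metis inner_gt_zero_iff not_le)
    with \<open>\<alpha> = 0\<close> c(1) show False by (simp add: c_eq zero_prod_def)
  qed
  ultimately have \<alpha>: "0 < \<alpha>" by simp
  have "- (1 / \<alpha>) *\<^sub>R a \<in> subdifferential g x"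
  proof -
    have "g x + (- (1 / \<alpha>) *\<^sub>R a) \<bullet> (y - x) \<le> g y" for y
    proof (rule dense_ge)
      fix r assume "g y < r"
      from sep[OF this] have "\<alpha> * (g x + (- (1 / \<alpha>) *\<^sub>R a) \<bullet> (y - x)) \<le> \<alpha> * r"
        using \<alpha> by (simp add: algebra_simps inner_diff_right)
      then show "g x + (- (1 / \<alpha>) *\<^sub>R a) \<bullet> (y - x) \<le> r" using \<alpha> by simp
    qed
    then show ?thesis by (simp add: subdifferential_def)
  qed
  then show ?thesis by blast
qed

section \<open>Strong convexity without subgradients, and growth at a minimizer\<close>

text \<open>In this form moduli add under sums and c = 0 is plain convexity, so that the proximal
  objective and F obtain their quadratic growth from the same lemma.\<close>

definition jensen_convex :: "real \<Rightarrow> ('a::real_inner \<Rightarrow> real) \<Rightarrow> bool" where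
  "jensen_convex c h \<longleftrightarrow> (\<forall>x y u. 0 \<le> u \<longrightarrow> u \<le> 1 \<longrightarrow>
     h ((1 - u) *\<^sub>R x + u *\<^sub>R y) \<le> (1 - u) * h x + u * h y - c / 2 * (u * (1 - u)) * (norm (x - y))\<^sup>2)"

lemma jensen_convexD:
  "jensen_convex c h \<Longrightarrow> 0 \<le> u \<Longrightarrow> u \<le> 1 \<Longrightarrow>
     h ((1 - u) *\<^sub>R x + u *\<^sub>R y) \<le> (1 - u) * h x + u * h y - c / 2 * (u * (1 - u)) * (norm (x - y))\<^sup>2"
  unfolding jensen_convex_def by blast

lemma convex_imp_jensen_convex:
  "convex_on UNIV h \<Longrightarrow> jensen_convex 0 h"
  by (auto simp: jensen_convex_def intro: convex_onD)

lemma jensen_convex_add: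
  assumes "jensen_convex c h" "jensen_convex c' h'"
  shows "jensen_convex (c + c') (\<lambda>x. h x + h' x)"
  unfolding jensen_convex_def
proof (intro allI impI)
  fix x y and u :: real assume u: "0 \<le> u" "u \<le> 1"
  show "h ((1 - u) *\<^sub>R x + u *\<^sub>R y) + h' ((1 - u) *\<^sub>R x + u *\<^sub>R y)
    \<le> (1 - u) * (h x + h' x) + u * (h y + h' y) - (c + c') / 2 * (u * (1 - u)) * (norm (x - y))\<^sup>2"
    using jensen_convexD[OF assms(1) u, of x y] jensen_convexD[OF assms(2) u, of x y]
    by (simp add: field_simps)
qed

text \<open>Use one subgradient at the intermediate point, towards x and towards y, with weights 1 -
  u and u. The linear terms cancel, and (1 - u) u^2 + u (1 - u)^2 = u (1 - u).\<close>

lemma strongly_convex_imp_jensen_convex: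
  fixes g :: "'a::euclidean_space \<Rightarrow> real"
  assumes "strongly_convex \<mu> g"
  shows "jensen_convex \<mu> g"
  unfolding jensen_convex_def
proof (intro allI impI)
  fix x y :: 'a and u :: real assume u: "0 \<le> u" "u \<le> 1"
  define z where "z = (1 - u) *\<^sub>R x + u *\<^sub>R y"
  obtain \<xi> where \<xi>: "\<xi> \<in> subdifferential g z"
    using subdifferential_nonempty assms unfolding strongly_convex_def by blast
  have *: "g z + \<xi> \<bullet> (v - z) + \<mu> / 2 * (norm (z - v))\<^sup>2 \<le> g v" for v
    using assms \<xi> by (auto simp: strongly_convex_def)
  have x: "x - z = - (u *\<^sub>R (y - x))" "z - x = u *\<^sub>R (y - x)" by (simp_all add: z_def algebra_simps)
  have y: "y - z = (1 - u) *\<^sub>R (y - x)" "z - y = - ((1 - u) *\<^sub>R (y - x))" by (simp_all add: z_def algebra_simps)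
  have X: "g z - u * (\<xi> \<bullet> (y - x)) + \<mu> / 2 * (u\<^sup>2 * (norm (y - x))\<^sup>2) \<le> g x"
    using *[of x] unfolding x by (simp add: power_mult_distrib)
  have Y: "g z + (1 - u) * (\<xi> \<bullet> (y - x)) + \<mu> / 2 * ((1 - u)\<^sup>2 * (norm (y - x))\<^sup>2) \<le> g y"
    using *[of y] unfolding y by (simp add: power_mult_distrib)
  have "(1 - u) * (g z - u * (\<xi> \<bullet> (y - x)) + \<mu> / 2 * (u\<^sup>2 * (norm (y - x))\<^sup>2))
      + u * (g z + (1 - u) * (\<xi> \<bullet> (y - x)) + \<mu> / 2 * ((1 - u)\<^sup>2 * (norm (y - x))\<^sup>2))
      \<le> (1 - u) * g x + u * g y"
    using u by (intro add_mono mult_left_mono X Y) auto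
  then show "g z \<le> (1 - u) * g x + u * g y - \<mu> / 2 * (u * (1 - u)) * (norm (x - y))\<^sup>2"
    by (simp add: norm_minus_commute[of x y]) (simp add: field_simps power2_eq_square)
qed

text \<open>For a quadratic the defect is exact, hence the introduction by
  \<open>eq_refl\<close>.\<close>

lemma jensen_convex_quadratic:
  fixes v a :: "'a::real_inner"
  shows "jensen_convex c (\<lambda>y. v \<bullet> (y - a) + c / 2 * (norm (y - a))\<^sup>2)"
  unfolding jensen_convex_def
proof (intro allI impI eq_refl)
  fix x y :: 'a and u :: real
  define p q where "p = x - a" and "q = y - a"
  have 1: "(1 - u) *\<^sub>R x + u *\<^sub>R y - a = (1 - u) *\<^sub>R p + u *\<^sub>R q"
    by (simp add: p_def q_def algebra_simps)
  have 2: "x - y = p - q" by (simp add: p_def q_def)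
  have 3: "(norm ((1 - u) *\<^sub>R p + u *\<^sub>R q))\<^sup>2
      = (1 - u) * (norm p)\<^sup>2 + u * (norm q)\<^sup>2 - u * (1 - u) * (norm (p - q))\<^sup>2"
    unfolding power2_norm_eq_inner
    by (simp add: inner_add_left inner_add_right inner_diff_left inner_diff_right inner_commute[of q p])
       (simp add: algebra_simps)
  show "v \<bullet> ((1 - u) *\<^sub>R x + u *\<^sub>R y - a) + c / 2 * (norm ((1 - u) *\<^sub>R x + u *\<^sub>R y - a))\<^sup>2
    = (1 - u) * (v \<bullet> (x - a) + c / 2 * (norm (x - a))\<^sup>2) + u * (v \<bullet> (y - a) + c / 2 * (norm (y - a))\<^sup>2)
      - c / 2 * (u * (1 - u)) * (norm (x - y))\<^sup>2"
    unfolding 1 2 3 by (simp add: p_def[symmetric] q_def[symmetric] inner_add_right inner_diff_right field_simps)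
qed

text \<open>Compare a with the point at fraction u of the way to z, divide by u, and let u tend to 0
  from the right so that the factor 1 - u disappears.\<close>

lemma jensen_convex_minimizer_growth:
  assumes "jensen_convex c h" and min: "\<And>y. h a \<le> h y"
  shows "h a + c / 2 * (norm (z - a))\<^sup>2 \<le> h z"
proof -
  have *: "c / 2 * (1 - u) * (norm (a - z))\<^sup>2 \<le> h z - h a" if u: "0 < u" "u < 1" for u :: real
  proof -
    have "h a \<le> (1 - u) * h a + u * h z - c / 2 * (u * (1 - u)) * (norm (a - z))\<^sup>2"
      using min jensen_convexD[OF assms(1), of u a z] u by (meson order_trans less_imp_le)
    then have "u * (c / 2 * (1 - u) * (norm (a - z))\<^sup>2) \<le> u * (h z - h a)"
      by (simp add: algebra_simps)
    with u show ?thesis by simp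
  qed
  have "((\<lambda>u. c / 2 * (1 - u) * (norm (a - z))\<^sup>2) \<longlongrightarrow> c / 2 * (1 - 0) * (norm (a - z))\<^sup>2) (at_right (0::real))"
    by (intro tendsto_intros)
  moreover have "eventually (\<lambda>u. c / 2 * (1 - u) * (norm (a - z))\<^sup>2 \<le> h z - h a) (at_right (0::real))"
    unfolding eventually_at_right_field by (intro exI[of _ 1]) (use * in auto)
  ultimately have "c / 2 * (1 - 0) * (norm (a - z))\<^sup>2 \<le> h z - h a"
    by (rule tendsto_upperbound) simp
  then show ?thesis by (simp add: norm_minus_commute)
qed

section \<open>The proximal step\<close>

text \<open>\<open>arg_min\<close> is a choice, so a minimizer must be exhibited. A subgradient of g
  at a bounds the objective below by a linear function plus the quadratic; this confines the search
  to a compact ball, on which the continuous objective attains its infimum.\<close>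

lemma prox_step_minimizes:
  fixes g :: "'a::euclidean_space \<Rightarrow> real" and \<omega> \<eta> :: real
  assumes g: "convex_on UNIV g" and c: "0 < \<omega> / \<eta>"
  defines "\<Phi> \<equiv> \<lambda>v a y. v \<bullet> (y - a) + \<omega> / (2 * \<eta>) * (norm (y - a))\<^sup>2 + g y"
  shows "\<Phi> v a (prox_step g \<eta> \<omega> v a) \<le> \<Phi> v a u"
proof -
  define c where "c = \<omega> / \<eta>"
  have c0: "0 < c" using assms by (simp add: c_def)
  obtain \<xi> where \<xi>: "\<And>y. g a + \<xi> \<bullet> (y - a) \<le> g y"
    using subdifferential_nonempty[OF g, of a] by (auto simp: subdifferential_def)
  \<comment> \<open>The radius from which c/2 r^2 outweighs the linear loss |v + \<xi>| r.\<close>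
  define R where "R = 2 * norm (v + \<xi>) / c"
  have far: "\<Phi> v a a \<le> \<Phi> v a y" if "y \<notin> cball a R" for y
  proof -
    have "R \<le> norm (y - a)" using that by (simp add: dist_norm norm_minus_commute)
    then have "norm (v + \<xi>) \<le> c / 2 * norm (y - a)" using c0 by (simp add: R_def field_simps)
    then have "norm (v + \<xi>) * norm (y - a) \<le> c / 2 * norm (y - a) * norm (y - a)"
      by (intro mult_right_mono) auto
    moreover have "- (norm (v + \<xi>) * norm (y - a)) \<le> (v + \<xi>) \<bullet> (y - a)"
      using Cauchy_Schwarz_ineq2[of "v + \<xi>" "y - a"] by linarith
    ultimately have "0 \<le> (v + \<xi>) \<bullet> (y - a) + c / 2 * (norm (y - a))\<^sup>2"
      by (simp add: power2_eq_square)
    with \<xi>[of y] show ?thesis by (simp add: \<Phi>_def c_def inner_add_left)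
  qed
  have "continuous_on UNIV g" by (rule convex_on_continuous[OF open_UNIV g])
  then have "continuous_on (cball a R) (\<Phi> v a)"
    unfolding \<Phi>_def by (intro continuous_intros) (auto intro: continuous_on_subset)
  moreover have aR: "a \<in> cball a R" using c0 by (simp add: R_def)
  ultimately obtain y0 where y0: "y0 \<in> cball a R" "\<And>y. y \<in> cball a R \<Longrightarrow> \<Phi> v a y0 \<le> \<Phi> v a y"
    using continuous_attains_inf[of "cball a R" "\<Phi> v a"] by auto
  have "\<Phi> v a y0 \<le> \<Phi> v a y" for y
    using y0(2)[of y] y0(2)[OF aR] far[of y] by (cases "y \<in> cball a R") auto
  then have "is_arg_min (\<Phi> v a) (\<lambda>_. True) y0" by (simp add: is_arg_min_linorder)
  then have "is_arg_min (\<Phi> v a) (\<lambda>_. True) (arg_min (\<Phi> v a) (\<lambda>_. True))"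
    unfolding arg_min_def by (rule someI)
  then show ?thesis unfolding is_arg_min_linorder by (simp add: prox_step_def \<Phi>_def)
qed

text \<open>Growth at the minimizer b: the quadratic contributes the modulus \<omega>/\<eta> and the
  convex g contributes 0.\<close>

lemma prox_step_three_point:
  fixes g :: "'a::euclidean_space \<Rightarrow> real" and \<omega> \<eta> :: real and v a :: 'a
  assumes g: "convex_on UNIV g" and c: "0 < \<omega> / \<eta>"
  defines "b \<equiv> prox_step g \<eta> \<omega> v a"
  shows "v \<bullet> (b - a) + \<omega> / (2 * \<eta>) * (norm (b - a))\<^sup>2 + g b + \<omega> / (2 * \<eta>) * (norm (u - b))\<^sup>2
    \<le> v \<bullet> (u - a) + \<omega> / (2 * \<eta>) * (norm (u - a))\<^sup>2 + g u"
proof -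
  have "jensen_convex (\<omega> / \<eta> + 0) (\<lambda>y. (v \<bullet> (y - a) + (\<omega> / \<eta>) / 2 * (norm (y - a))\<^sup>2) + g y)"
    by (intro jensen_convex_add jensen_convex_quadratic convex_imp_jensen_convex g)
  from jensen_convex_minimizer_growth[OF this, of b u] prox_step_minimizes[OF g c, of v a]
  show ?thesis by (simp add: b_def mult.commute)
qed

subsection \<open>The variance-reduced gradient\<close>

locale svrg_setting =
  fixes f :: "nat \<Rightarrow> 'a::euclidean_space \<Rightarrow> real" and L p :: "nat \<Rightarrow> real" and n :: nat
  assumes f_convex: "\<And>i. i \<in> {1..n} \<Longrightarrow> convex_on UNIV (f i)"
    and L_pos: "\<And>i. i \<in> {1..n} \<Longrightarrow> L i > 0"
    and f_smooth: "\<And>i. i \<in> {1..n} \<Longrightarrow> L_smooth (L i) (f i)"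
    and p_pos: "\<And>i. i \<in> {1..n} \<Longrightarrow> p i > 0"
    and p_sum: "(\<Sum>i=1..n. p i) = 1"
begin

lemma n_pos: "n > 0"
  using p_sum by (cases n) auto

lemma f_differentiable: "i \<in> {1..n} \<Longrightarrow> f i differentiable (at x)"
  using f_smooth by (auto simp: L_smooth_def)

lemma gradient_average_f: "gradient (average n f) x = (1 / real n) *\<^sub>R (\<Sum>i=1..n. gradient (f i) x)"
  by (intro gradient_average f_differentiable)

lemma L_le_L_tilde:
  assumes "i \<in> {1..n}"
  shows "L i / (real n * p i) \<le> L_tilde n p L"
  unfolding L_tilde_def using assms by (intro Max_ge) auto

lemma L_tilde_pos: "0 < L_tilde n p L"
proof -
  have 1: "1 \<in> {1..n}" using n_pos by auto
  then have "0 < L 1 / (real n * p 1)" using L_pos p_pos n_pos by simp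
  with L_le_L_tilde[OF 1] show ?thesis by linarith
qed

text \<open>The mean of the L i is the p-weighted mean of the ratios L i / (n p i), hence at most
  their maximum. Thus \<open>L_tilde\<close> also serves as a smoothness constant of the
  average.\<close>

lemma mean_L_le_L_tilde: "(1 / real n) * (\<Sum>i=1..n. L i) \<le> L_tilde n p L"
proof -
  have "(1 / real n) * (\<Sum>i=1..n. L i) = (\<Sum>i=1..n. p i * (L i / (real n * p i)))"
    using p_pos by (auto simp: sum_distrib_left intro!: sum.cong)
      (metis order_less_irrefl)
  also have "\<dots> \<le> (\<Sum>i=1..n. p i * L_tilde n p L)"
    by (intro sum_mono mult_left_mono L_le_L_tilde) (use p_pos in \<open>auto intro: less_imp_le\<close>)
  also have "\<dots> = L_tilde n p L" by (simp add: sum_distrib_right[symmetric] p_sum del: One_nat_def)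
  finally show ?thesis .
qed

lemma average_convex: "convex_on UNIV (average n f)"
proof -
  have "convex_on UNIV (\<lambda>x. \<Sum>i\<in>A. f i x)" if "finite A" "A \<subseteq> {1..n}" for A
    using that by (induction A rule: finite_induct) (auto intro!: convex_on_add f_convex simp: convex_on_const)
  then have "convex_on UNIV (\<lambda>x. \<Sum>i=1..n. f i x)" by simp
  from convex_on_cmul[OF _ this, of "1 / real n"] show ?thesis
    unfolding average_def[abs_def] by simp
qed

lemma average_above_tangent:
  "average n f x + gradient (average n f) x \<bullet> (y - x) \<le> average n f y"
proof (rule convex_above_tangent[OF average_convex])
  show "average n f differentiable (at x)"
    unfolding average_def[abs_def] by (intro differentiable_mult differentiable_sum differentiable_const)
      (auto intro: f_differentiable)
qed

lemma average_descent:
  "average n f y \<le> average n f x + gradient (average n f) x \<bullet> (y - x) + L_tilde n p L / 2 * (norm (y - x))\<^sup>2"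
proof -
  have sum_L: "(\<Sum>i=1..n. L i / 2 * (norm (y - x))\<^sup>2) = (\<Sum>i=1..n. L i) / 2 * (norm (y - x))\<^sup>2"
    by (simp only: sum_divide_distrib sum_distrib_right)
  have "average n f y \<le> (1 / real n) * (\<Sum>i=1..n. f i x + gradient (f i) x \<bullet> (y - x) + L i / 2 * (norm (y - x))\<^sup>2)"
    unfolding average_def by (intro mult_left_mono sum_mono smooth_descent f_smooth) auto
  also have "\<dots> = average n f x + gradient (average n f) x \<bullet> (y - x)
      + (1 / real n) * (\<Sum>i=1..n. L i) / 2 * (norm (y - x))\<^sup>2"
    unfolding sum.distrib sum_L
    by (simp add: average_def gradient_average_f inner_sum_left distrib_left del: One_nat_def)
  also have "\<dots> \<le> average n f x + gradient (average n f) x \<bullet> (y - x) + L_tilde n p L / 2 * (norm (y - x))\<^sup>2"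
    using mean_L_le_L_tilde by (intro add_left_mono mult_right_mono divide_right_mono) auto
  finally show ?thesis .
qed

text \<open>The probabilities cancel the importance weights, and the two gradients of the average at
  the snapshot cancel each other.\<close>

lemma svrg_gradient_unbiased:
  "(\<Sum>i=1..n. p i *\<^sub>R svrg_gradient n p f z i x) = gradient (average n f) x"
proof -
  have "p i *\<^sub>R svrg_gradient n p f z i x
      = (1 / real n) *\<^sub>R gradient (f i) x - (1 / real n) *\<^sub>R gradient (f i) z
        + p i *\<^sub>R gradient (average n f) z" if "i \<in> {1..n}" for i
    using p_pos[OF that] by (simp add: svrg_gradient_def algebra_simps)
  then have "(\<Sum>i=1..n. p i *\<^sub>R svrg_gradient n p f z i x)
      = (\<Sum>i=1..n. (1 / real n) *\<^sub>R gradient (f i) x - (1 / real n) *\<^sub>R gradient (f i) z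
        + p i *\<^sub>R gradient (average n f) z)"
    by (intro sum.cong) auto
  also have "\<dots> = gradient (average n f) x - gradient (average n f) z
      + (\<Sum>i=1..n. p i) *\<^sub>R gradient (average n f) z"
    unfolding sum.distrib sum_subtractf scaleR_sum_left[symmetric]
    by (simp only: gradient_average_f scaleR_sum_right)
  finally show ?thesis by (simp add: p_sum del: One_nat_def)
qed

text \<open>The variance is at most the second moment of \<open>(\<nabla>f\<^sub>i(x) - \<nabla>f\<^sub>i(z)) / (n p\<^sub>i)\<close>, to which
  co-coercivity applies.\<close>
lemma svrg_gradient_variance:
  "(\<Sum>i=1..n. p i * (norm (svrg_gradient n p f z i x - gradient (average n f) x))\<^sup>2)
    \<le> 2 * L_tilde n p L * (average n f z - average n f x - gradient (average n f) x \<bullet> (z - x))"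
proof -
  define w where "w = (\<lambda>i. (1 / (real n * p i)) *\<^sub>R (gradient (f i) x - gradient (f i) z))"
  define e where "e = gradient (average n f) x - gradient (average n f) z"
  define B where "B = (\<lambda>i. f i z - f i x - gradient (f i) x \<bullet> (z - x))"
  have diff: "svrg_gradient n p f z i x - gradient (average n f) x = w i - e" for i
    by (simp add: svrg_gradient_def w_def e_def)
  have "(\<Sum>i=1..n. p i *\<^sub>R w i)
      = (\<Sum>i=1..n. p i *\<^sub>R svrg_gradient n p f z i x - p i *\<^sub>R gradient (average n f) z)"
    by (intro sum.cong) (auto simp: svrg_gradient_def w_def algebra_simps)
  then have we: "(\<Sum>i=1..n. p i *\<^sub>R w i) = e"
    by (simp add: sum_subtractf svrg_gradient_unbiased scaleR_sum_left[symmetric] p_sum e_def del: One_nat_def)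
  have "(\<Sum>i=1..n. p i * (norm (w i - e))\<^sup>2)
      = (\<Sum>i=1..n. p i * (norm (w i))\<^sup>2 - 2 * ((p i *\<^sub>R w i) \<bullet> e) + p i * (norm e)\<^sup>2)"
    by (intro sum.cong)
       (auto simp: power2_norm_eq_inner inner_diff_left inner_diff_right inner_commute algebra_simps)
  also have "\<dots> = (\<Sum>i=1..n. p i * (norm (w i))\<^sup>2) - 2 * ((\<Sum>i=1..n. p i *\<^sub>R w i) \<bullet> e) + (\<Sum>i=1..n. p i) * (norm e)\<^sup>2"
    by (simp add: sum.distrib sum_subtractf inner_sum_left sum_distrib_left sum_distrib_right)
  also have "\<dots> = (\<Sum>i=1..n. p i * (norm (w i))\<^sup>2) - (norm e)\<^sup>2"
    unfolding we p_sum by (simp add: power2_norm_eq_inner)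
  also have "\<dots> \<le> (\<Sum>i=1..n. p i * (norm (w i))\<^sup>2)" by simp
  also have "\<dots> \<le> (\<Sum>i=1..n. (1 / real n) * (2 * L_tilde n p L * B i))"
  proof (rule sum_mono)
    fix i assume i: "i \<in> {1..n}"
    have B: "0 \<le> B i"
      using convex_above_tangent[OF f_convex[OF i] f_differentiable[OF i], of x z] by (simp add: B_def)
    have "norm (w i) = 1 / (real n * p i) * norm (gradient (f i) x - gradient (f i) z)"
      using p_pos[OF i] by (simp add: w_def)
    then have "p i * (norm (w i))\<^sup>2
        = (1 / real n) * (1 / (real n * p i)) * (norm (gradient (f i) x - gradient (f i) z))\<^sup>2"
      using p_pos[OF i] n_pos by (simp add: power2_eq_square field_simps)
    also have "\<dots> \<le> (1 / real n) * (1 / (real n * p i)) * (2 * L i * B i)"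
      unfolding B_def using p_pos[OF i] n_pos
      by (intro mult_left_mono smooth_convex_cocoercive f_convex f_smooth L_pos i) auto
    also have "\<dots> = (1 / real n) * (2 * (L i / (real n * p i)) * B i)" by simp
    also have "\<dots> \<le> (1 / real n) * (2 * L_tilde n p L * B i)"
      using B L_le_L_tilde[OF i] by (intro mult_left_mono mult_right_mono) auto
    finally show "p i * (norm (w i))\<^sup>2 \<le> (1 / real n) * (2 * L_tilde n p L * B i)" .
  qed
  also have "\<dots> = 2 * L_tilde n p L * ((1 / real n) * (\<Sum>i=1..n. B i))"
    by (simp add: sum_distrib_left mult_ac)
  also have "(1 / real n) * (\<Sum>i=1..n. B i)
      = average n f z - average n f x - gradient (average n f) x \<bullet> (z - x)"
    by (simp add: B_def average_def gradient_average_f sum_subtractf inner_sum_left right_diff_distrib)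
  finally show ?thesis by (simp add: diff)
qed

text \<open>The terms carrying the gradient noise are split by Young's inequality with parameter
  \<open>1/\<eta> - L_tilde\<close>, so that they merge with the smoothness term into \<open>1/(2\<eta>)\<close> times the squared
  step. The bound on \<open>\<omega>\<close> says that the remaining multiple of the Bregman distance between
  \<open>z\<close> and \<open>x\<close> is at most \<open>1 - \<omega>\<close>, which cancels against the convex combination defining \<open>x\<close>.\<close>
lemma asvrg_step:
  assumes g: "convex_on UNIV g"
    and eta: "0 < \<eta>" "\<eta> < 1 / L_tilde n p L"
    and omega: "0 < \<omega>" "\<omega> \<le> 1 - L_tilde n p L * \<eta> / (1 - L_tilde n p L * \<eta>)"
    and x: "x = z + \<omega> *\<^sub>R (y - z)"
  defines "F \<equiv> \<lambda>x. average n f x + g x"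
    and "y' \<equiv> \<lambda>i. prox_step g \<eta> \<omega> (svrg_gradient n p f z i x) y"
  shows "(\<Sum>i=1..n. p i * (F (z + \<omega> *\<^sub>R (y' i - z)) + \<omega>\<^sup>2 / (2 * \<eta>) * (norm (u - y' i))\<^sup>2))
    \<le> (1 - \<omega>) * F z + \<omega> * F u + \<omega>\<^sup>2 / (2 * \<eta>) * (norm (u - y))\<^sup>2"
proof -
  define \<Lambda> where "\<Lambda> = L_tilde n p L"
  define \<beta> where "\<beta> = 1 / \<eta> - \<Lambda>"
  define G where "G = gradient (average n f) x"
  define v where "v = (\<lambda>i. svrg_gradient n p f z i x)"
  define D where "D = average n f z - average n f x - G \<bullet> (z - x)"
  have \<Lambda>: "0 < \<Lambda>" by (simp add: \<Lambda>_def L_tilde_pos)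
  have \<Lambda>\<eta>: "\<Lambda> * \<eta> < 1" using eta \<Lambda> by (simp add: \<Lambda>_def field_simps)
  then have \<beta>: "0 < \<beta>" using eta by (simp add: \<beta>_def field_simps)
  have \<Lambda>\<beta>: "\<Lambda> / \<beta> = \<Lambda> * \<eta> / (1 - \<Lambda> * \<eta>)"
    using eta \<Lambda>\<eta> by (simp add: \<beta>_def field_simps)
  with omega(2) have \<sigma>: "\<Lambda> / \<beta> \<le> 1 - \<omega>" by (simp add: \<Lambda>_def)
  have "0 \<le> \<Lambda> / \<beta>" using \<Lambda> \<beta> by simp
  \<comment> \<open>The bound on the momentum thus contains \<omega> \<le> 1, which makes x' a
    convex combination of z and y'.\<close>
  with \<sigma> have \<omega>1: "\<omega> \<le> 1" by linarith
  have D0: "0 \<le> D" using average_above_tangent[of x z] by (simp add: D_def G_def)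
  \<comment> \<open>Collects the terms that do not depend on the drawn index.\<close>
  define C where "C = average n f x + (1 - \<omega>) * g z + \<omega> * g u + \<omega>\<^sup>2 / (2 * \<eta>) * (norm (u - y))\<^sup>2"
  have step: "F (z + \<omega> *\<^sub>R (y' i - z)) + \<omega>\<^sup>2 / (2 * \<eta>) * (norm (u - y' i))\<^sup>2
      \<le> C + \<omega> * (v i \<bullet> (u - y)) + 1 / (2 * \<beta>) * (norm (v i - G))\<^sup>2" for i
  proof -
    define x' where "x' = z + \<omega> *\<^sub>R (y' i - z)"
    have dx: "x' - x = \<omega> *\<^sub>R (y' i - y)" by (simp add: x'_def x algebra_simps)
    have 1: "average n f x' \<le> average n f x + G \<bullet> (x' - x) + \<Lambda> / 2 * (norm (x' - x))\<^sup>2"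
      unfolding G_def \<Lambda>_def by (rule average_descent)
    have 2: "(G - v i) \<bullet> (x' - x) \<le> 1 / (2 * \<beta>) * (norm (v i - G))\<^sup>2 + \<beta> / 2 * (norm (x' - x))\<^sup>2"
    proof -
      have "0 \<le> (norm ((v i - G) + \<beta> *\<^sub>R (x' - x)))\<^sup>2" by simp
      also have "\<dots> = (norm (v i - G))\<^sup>2 - 2 * \<beta> * ((G - v i) \<bullet> (x' - x)) + \<beta>\<^sup>2 * (norm (x' - x))\<^sup>2"
        unfolding power2_norm_eq_inner
        by (simp add: inner_add_left inner_add_right inner_diff_left inner_diff_right inner_commute
            power2_eq_square algebra_simps)
      finally show ?thesis using \<beta> by (simp add: field_simps power2_eq_square)
    qed
    have "x' = (1 - \<omega>) *\<^sub>R z + \<omega> *\<^sub>R y' i" by (simp add: x'_def algebra_simps)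
    then have 3: "g x' \<le> (1 - \<omega>) * g z + \<omega> * g (y' i)"
      using convex_onD[OF g, of \<omega> z "y' i"] omega(1) \<omega>1 by simp
    have "v i \<bullet> (y' i - y) + \<omega> / (2 * \<eta>) * (norm (y' i - y))\<^sup>2 + g (y' i) + \<omega> / (2 * \<eta>) * (norm (u - y' i))\<^sup>2
      \<le> v i \<bullet> (u - y) + \<omega> / (2 * \<eta>) * (norm (u - y))\<^sup>2 + g u"
      unfolding y'_def v_def using omega(1) eta(1) by (intro prox_step_three_point g) auto
    then have "\<omega> * (v i \<bullet> (y' i - y) + \<omega> / (2 * \<eta>) * (norm (y' i - y))\<^sup>2 + g (y' i) + \<omega> / (2 * \<eta>) * (norm (u - y' i))\<^sup>2)
      \<le> \<omega> * (v i \<bullet> (u - y) + \<omega> / (2 * \<eta>) * (norm (u - y))\<^sup>2 + g u)"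
      using omega(1) by (intro mult_left_mono) auto
    then have 4: "v i \<bullet> (x' - x) + 1 / (2 * \<eta>) * (norm (x' - x))\<^sup>2 + \<omega> * g (y' i) + \<omega>\<^sup>2 / (2 * \<eta>) * (norm (u - y' i))\<^sup>2
      \<le> \<omega> * (v i \<bullet> (u - y)) + \<omega>\<^sup>2 / (2 * \<eta>) * (norm (u - y))\<^sup>2 + \<omega> * g u"
      unfolding dx by (simp add: power_mult_distrib power2_eq_square distrib_left mult_ac)
    have 5: "\<Lambda> / 2 * (norm (x' - x))\<^sup>2 + \<beta> / 2 * (norm (x' - x))\<^sup>2 = 1 / (2 * \<eta>) * (norm (x' - x))\<^sup>2"
      by (simp add: \<beta>_def field_simps)
    from 1 2 3 4 5 show ?thesis
      unfolding F_def C_def x'_def[symmetric] inner_diff_left by linarith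
  qed
  have "(\<Sum>i=1..n. p i * (F (z + \<omega> *\<^sub>R (y' i - z)) + \<omega>\<^sup>2 / (2 * \<eta>) * (norm (u - y' i))\<^sup>2))
    \<le> (\<Sum>i=1..n. p i * (C + \<omega> * (v i \<bullet> (u - y)) + 1 / (2 * \<beta>) * (norm (v i - G))\<^sup>2))"
    by (intro sum_mono mult_left_mono step) (use p_pos in \<open>auto intro: less_imp_le\<close>)
  \<comment> \<open>Unbiasedness applies because v i is now paired with the fixed vector u - y. Its
    pairing with x' - x, which itself depends on i, had to be removed beforehand.\<close>
  also have "\<dots> = (\<Sum>i=1..n. p i) * C + \<omega> * ((\<Sum>i=1..n. p i *\<^sub>R v i) \<bullet> (u - y))
      + 1 / (2 * \<beta>) * (\<Sum>i=1..n. p i * (norm (v i - G))\<^sup>2)"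
    by (simp add: distrib_left sum.distrib inner_sum_left sum_distrib_left sum_distrib_right mult_ac
        del: sum_divide_distrib)
  also have "\<dots> \<le> C + \<omega> * (G \<bullet> (u - y)) + \<Lambda> / \<beta> * D"
  proof -
    have "1 / (2 * \<beta>) * (\<Sum>i=1..n. p i * (norm (v i - G))\<^sup>2) \<le> 1 / (2 * \<beta>) * (2 * \<Lambda> * D)"
      unfolding v_def G_def \<Lambda>_def D_def using \<beta> by (intro mult_left_mono svrg_gradient_variance) auto
    then show ?thesis unfolding p_sum v_def svrg_gradient_unbiased by (simp add: G_def)
  qed
  also have "\<dots> \<le> C + \<omega> * (G \<bullet> (u - y)) + (1 - \<omega>) * D"
    using \<sigma> D0 by (intro add_left_mono mult_right_mono) auto
  also have "\<dots> \<le> (1 - \<omega>) * F z + \<omega> * F u + \<omega>\<^sup>2 / (2 * \<eta>) * (norm (u - y))\<^sup>2"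
  proof -
    \<comment> \<open>The gradient terms thus combine into \<omega> times the tangent of the average
      at x towards u, and the values of the average at x left in \<open>C\<close> and (1 - \<omega>)
      D add up to the matching weight \<omega>.\<close>
    have "\<omega> *\<^sub>R (u - y) - (1 - \<omega>) *\<^sub>R (z - x) = \<omega> *\<^sub>R (u - x)" by (simp add: x algebra_simps)
    then have "\<omega> * (G \<bullet> (u - y)) - (1 - \<omega>) * (G \<bullet> (z - x)) = \<omega> * (G \<bullet> (u - x))"
      by (metis inner_diff_right inner_scaleR_right)
    moreover have "\<omega> * (average n f x + G \<bullet> (u - x)) \<le> \<omega> * average n f u"
      unfolding G_def using omega(1) by (intro mult_left_mono average_above_tangent) auto
    ultimately show ?thesis by (simp add: C_def D_def F_def algebra_simps)
  qed
  finally show ?thesis .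
qed

end

subsection \<open>Expectations over the index path\<close>

context prob_space
begin

text \<open>The relevant coordinates form a random element of a finite discrete space, on which any
  function is measurable and bounded. No regularity of h is involved.\<close>

lemma integrable_finite_indep:
  fixes h :: "('k \<Rightarrow> 'b) \<Rightarrow> real"
  assumes X: "indep_vars (\<lambda>_. count_space B) X I" and fin: "finite I" "finite B"
    and dep: "\<And>a a'. (\<And>k. k \<in> I \<Longrightarrow> a k = a' k) \<Longrightarrow> h a = h a'"
  shows "integrable M (\<lambda>w. h (\<lambda>k. X k w))"
proof -
  \<comment> \<open>Elements of the product space are extensional, hence the restriction;
    \<open>dep\<close> makes it invisible to h.\<close>
  define R where "R = (\<lambda>w. restrict (\<lambda>k. X k w) I)"
  have eq: "h (\<lambda>k. X k w) = h (R w)" for w by (rule dep) (simp add: R_def)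
  have "R \<in> measurable M (PiM I (\<lambda>_. count_space B))"
    unfolding R_def using X by (intro measurable_restrict) (auto simp: indep_vars_def)
  then have R: "R \<in> measurable M (count_space (PiE I (\<lambda>_. B)))"
    using fin by (simp add: count_space_PiM_finite countable_finite)
  have "integrable M (\<lambda>w. h (R w))"
  proof (rule integrable_const_bound)
    show "AE w in M. norm (h (R w)) \<le> (\<Sum>a\<in>PiE I (\<lambda>_. B). norm (h a))"
    proof (rule AE_I2)
      fix w assume "w \<in> space M"
      then have "R w \<in> PiE I (\<lambda>_. B)" using measurable_space[OF R] by simp
      then show "norm (h (R w)) \<le> (\<Sum>a\<in>PiE I (\<lambda>_. B). norm (h a))"
        by (rule member_le_sum) (auto intro: finite_PiE fin)
    qed
    show "(\<lambda>w. h (R w)) \<in> borel_measurable M"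
      by (rule measurable_compose[OF R]) simp
  qed
  then show ?thesis by (simp add: eq)
qed

text \<open>Averaging out a fresh draw without conditional expectations: split over the value b of X
  k, factor each term by independence, and reassemble.\<close>

lemma expectation_indep_draw:
  fixes h :: "('k \<Rightarrow> 'b) \<Rightarrow> 'b \<Rightarrow> real"
  assumes X: "indep_vars (\<lambda>_. count_space B) X I" and fin: "finite I" "finite B"
    and J: "J \<subseteq> I" and k: "k \<in> I - J"
    and q: "\<And>b. b \<in> B \<Longrightarrow> prob {w \<in> space M. X k w = b} = q b"
    and dep: "\<And>a a' b. (\<And>j. j \<in> J \<Longrightarrow> a j = a' j) \<Longrightarrow> h a b = h a' b"
  shows "expectation (\<lambda>w. h (\<lambda>j. X j w) (X k w)) = expectation (\<lambda>w. \<Sum>b\<in>B. q b * h (\<lambda>j. X j w) b)"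
proof -
  have "X k \<in> measurable M (count_space B)" using X k by (auto simp: indep_vars_def)
  \<comment> \<open>Measurability into \<open>count_space B\<close> confines the values to B at
    every sample point, not merely almost surely.\<close>
  then have XB: "X k w \<in> B" if "w \<in> space M" for w
    using that by (auto dest: measurable_space)
  have finJ: "finite J" using J fin(1) by (rule finite_subset)
  have int_h: "integrable M (\<lambda>w. h (\<lambda>j. X j w) b)" for b
    by (rule integrable_finite_indep[OF indep_vars_subset[OF X J] finJ fin(2)]) (rule dep)
  have int_i: "integrable M (\<lambda>w. indicator {b} (X k w) :: real)" for b
    by (rule integrable_finite_indep[OF indep_vars_subset[OF X, of "{k}"], of "\<lambda>a. indicator {b} (a k)"])
       (use k fin in auto)
  have ind: "indep_var borel (\<lambda>w. h (\<lambda>j. X j w) b) borel (\<lambda>w. indicator {b} (X k w) :: real)" for b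
  proof -
    have "indep_var borel ((\<lambda>a. h a b) \<circ> (\<lambda>w. restrict (\<lambda>j. X j w) J))
        borel ((\<lambda>a. indicator {b} (a k) :: real) \<circ> (\<lambda>w. restrict (\<lambda>j. X j w) {k}))"
    proof (rule indep_var_compose[OF indep_var_restrict[OF X]])
      show "(\<lambda>a. h a b) \<in> borel_measurable (PiM J (\<lambda>_. count_space B))"
        using fin finJ by (simp add: count_space_PiM_finite countable_finite)
      show "(\<lambda>a. indicator {b} (a k) :: real) \<in> borel_measurable (PiM {k} (\<lambda>_. count_space B))"
        using fin by (simp add: count_space_PiM_finite countable_finite)
    qed (use J k in auto)
    moreover have "h (restrict (\<lambda>j. X j w) J) b = h (\<lambda>j. X j w) b" for w by (rule dep) simp
    ultimately show ?thesis by (simp add: comp_def)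
  qed
  have split: "h (\<lambda>j. X j w) (X k w) = (\<Sum>b\<in>B. h (\<lambda>j. X j w) b * indicator {b} (X k w))"
    if "w \<in> space M" for w
  proof -
    have "(\<Sum>b\<in>B. h (\<lambda>j. X j w) b * indicator {b} (X k w))
        = (\<Sum>b\<in>B. if b = X k w then h (\<lambda>j. X j w) b else 0)"
      by (intro sum.cong) (auto simp: indicator_def)
    then show ?thesis using XB[OF that] fin(2) by simp
  qed
  have "expectation (\<lambda>w. h (\<lambda>j. X j w) (X k w))
      = expectation (\<lambda>w. \<Sum>b\<in>B. h (\<lambda>j. X j w) b * indicator {b} (X k w))"
    by (intro Bochner_Integration.integral_cong refl split)
  also have "\<dots> = (\<Sum>b\<in>B. expectation (\<lambda>w. h (\<lambda>j. X j w) b * indicator {b} (X k w)))"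
    by (intro Bochner_Integration.integral_sum indep_var_integrable ind int_h int_i)
  also have "\<dots> = (\<Sum>b\<in>B. q b * expectation (\<lambda>w. h (\<lambda>j. X j w) b))"
  proof (rule sum.cong)
    fix b assume b: "b \<in> B"
    have "expectation (\<lambda>w. indicator {b} (X k w)) = expectation (indicator {w \<in> space M. X k w = b})"
      by (intro Bochner_Integration.integral_cong) (auto simp: indicator_def)
    also have "\<dots> = q b" using q[OF b] by (simp add: Int_absorb2 subset_eq)
    finally show "expectation (\<lambda>w. h (\<lambda>j. X j w) b * indicator {b} (X k w)) = q b * expectation (\<lambda>w. h (\<lambda>j. X j w) b)"
      by (simp add: indep_var_lebesgue_integral[OF ind int_h int_i])
  qed simp
  also have "\<dots> = expectation (\<lambda>w. \<Sum>b\<in>B. q b * h (\<lambda>j. X j w) b)"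
    by (simp add: Bochner_Integration.integral_sum int_h)
  finally show ?thesis .
qed

end

section \<open>Iterates as functions of the index path\<close>

lemma asvrg_epoch_cong:
  assumes "\<And>j. j \<in> {1..t} \<Longrightarrow> i j = i' j"
  shows "asvrg_epoch n p f g \<eta> \<omega> z i t = asvrg_epoch n p f g \<eta> \<omega> z i' t"
  using assms by (induction t) auto

lemma asvrg_snapshot_cong:
  assumes "\<And>r t. r \<in> {1..s} \<Longrightarrow> t \<in> {1..m} \<Longrightarrow> i r t = i' r t"
  shows "asvrg_snapshot n p f g \<eta> \<omega> m x0 i s = asvrg_snapshot n p f g \<eta> \<omega> m x0 i' s"
  using assms
proof (induction s)
  case (Suc s)
  then have "asvrg_snapshot n p f g \<eta> \<omega> m x0 i s = asvrg_snapshot n p f g \<eta> \<omega> m x0 i' s" by simp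
  moreover have "asvrg_epoch n p f g \<eta> \<omega> z (i (Suc s)) t = asvrg_epoch n p f g \<eta> \<omega> z (i' (Suc s)) t"
    if "t \<in> {1..m}" for t z
    using that by (intro asvrg_epoch_cong Suc.prems) auto
  ultimately show ?case by simp
qed simp

text \<open>True at t = 0 as well, where both components are z. Hence the x-iterates always have the
  form that \<open>asvrg_step\<close> expects.\<close>

lemma fst_asvrg_epoch:
  "fst (asvrg_epoch n p f g \<eta> \<omega> z i t) = z + \<omega> *\<^sub>R (snd (asvrg_epoch n p f g \<eta> \<omega> z i t) - z)"
  by (cases t) (auto simp: Let_def split: prod.split)

lemma snd_asvrg_epoch_Suc:
  "snd (asvrg_epoch n p f g \<eta> \<omega> z i (Suc t)) =
    prox_step g \<eta> \<omega> (svrg_gradient n p f z (i (Suc t)) (fst (asvrg_epoch n p f g \<eta> \<omega> z i t)))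
      (snd (asvrg_epoch n p f g \<eta> \<omega> z i t))"
  by (auto simp: Let_def split: prod.split)

locale asvrg = svrg_setting f L p n + prob_space M
  for f :: "nat \<Rightarrow> 'a::euclidean_space \<Rightarrow> real" and L p :: "nat \<Rightarrow> real" and n :: nat
    and M :: "'w measure" +
  fixes g :: "'a \<Rightarrow> real" and m S :: nat and \<mu> \<eta> \<omega> :: real and x0 xstar :: 'a
    and idx :: "nat \<Rightarrow> nat \<Rightarrow> 'w \<Rightarrow> nat"
  assumes mu_pos: "\<mu> > 0"
    and g_strongly_convex: "strongly_convex \<mu> g"
    and xstar_min: "\<And>x. average n f xstar + g xstar \<le> average n f x + g x"
    and eta: "0 < \<eta>" "\<eta> < 1 / L_tilde n p L"
    and omega: "0 < \<omega>" "\<omega> \<le> 1 - L_tilde n p L * \<eta> / (1 - L_tilde n p L * \<eta>)"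
    and m_pos: "m \<ge> 1"
    and idx: "iid_indices M n p S m idx"
begin

definition objective :: "'a \<Rightarrow> real" where "objective x = average n f x + g x"

definition draw :: "nat \<times> nat \<Rightarrow> 'w \<Rightarrow> nat" where "draw = (\<lambda>(s, t). idx s t)"

text \<open>The argument is a deterministic path; randomness enters only when \<open>draw\<close> is
  substituted, so dependence on indices can be stated as a congruence.\<close>

definition snap :: "nat \<Rightarrow> (nat \<times> nat \<Rightarrow> nat) \<Rightarrow> 'a" where
  "snap s a = asvrg_snapshot n p f g \<eta> \<omega> m x0 (\<lambda>s t. a (s, t)) s"

definition iter :: "nat \<Rightarrow> nat \<Rightarrow> (nat \<times> nat \<Rightarrow> nat) \<Rightarrow> 'a \<times> 'a" where
  "iter s t a = asvrg_epoch n p f g \<eta> \<omega> (snap s a) (\<lambda>t. a (Suc s, t)) t"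

text \<open>The indices visible to \<open>iter s t\<close>, which runs in epoch
  \<open>Suc s\<close>: all of the first s epochs and t draws of the current one.\<close>

definition past :: "nat \<Rightarrow> nat \<Rightarrow> (nat \<times> nat) set" where
  "past s t = {1..s} \<times> {1..m} \<union> {Suc s} \<times> {1..t}"

lemma snap_cong:
  assumes "\<And>k. k \<in> {1..s} \<times> {1..m} \<Longrightarrow> a k = a' k"
  shows "snap s a = snap s a'"
  unfolding snap_def by (intro asvrg_snapshot_cong assms) auto

lemma iter_cong:
  assumes "\<And>k. k \<in> past s t \<Longrightarrow> a k = a' k"
  shows "iter s t a = iter s t a'"
proof -
  have "snap s a = snap s a'" by (intro snap_cong assms) (auto simp: past_def)
  then show ?thesis
    unfolding iter_def by (auto intro!: asvrg_epoch_cong assms simp: past_def)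
qed

lemma g_convex: "convex_on UNIV g"
  using g_strongly_convex by (simp add: strongly_convex_def)

lemma objective_convex: "convex_on UNIV objective"
  unfolding objective_def[abs_def] by (intro convex_on_add average_convex g_convex)

text \<open>The average contributes modulus 0 and g contributes \<mu>.\<close>

lemma objective_growth: "objective xstar + \<mu> / 2 * (norm (z - xstar))\<^sup>2 \<le> objective z"
proof -
  have "jensen_convex (0 + \<mu>) (\<lambda>x. average n f x + g x)"
    by (intro jensen_convex_add convex_imp_jensen_convex average_convex
        strongly_convex_imp_jensen_convex g_strongly_convex)
  from jensen_convex_minimizer_growth[OF this, of xstar z] xstar_min show ?thesis
    by (simp add: objective_def)
qed

lemma draw_indep: "indep_vars (\<lambda>_. count_space {1..n}) draw ({1..S} \<times> {1..m})"
  using idx by (simp add: iid_indices_def draw_def)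

lemma draw_prob:
  "k \<in> {1..S} \<times> {1..m} \<Longrightarrow> i \<in> {1..n} \<Longrightarrow> prob {w \<in> space M. draw k w = i} = p i"
  using idx by (cases k) (auto simp: iid_indices_def draw_def)

lemma integrable_path:
  fixes h :: "(nat \<times> nat \<Rightarrow> nat) \<Rightarrow> real"
  assumes "\<And>a a'. (\<And>k. k \<in> {1..S} \<times> {1..m} \<Longrightarrow> a k = a' k) \<Longrightarrow> h a = h a'"
  shows "integrable M (\<lambda>w. h (\<lambda>k. draw k w))"
proof (rule integrable_finite_indep[OF draw_indep])
  show "h a = h a'" if "\<And>k. k \<in> {1..S} \<times> {1..m} \<Longrightarrow> a k = a' k" for a a'
    using that by (rule assms)
qed simp_all

lemma integrable_snap:
  fixes h :: "'a \<Rightarrow> real"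
  assumes "s \<le> S"
  shows "integrable M (\<lambda>w. h (snap s (\<lambda>k. draw k w)))"
proof (rule integrable_path)
  fix a a' :: "nat \<times> nat \<Rightarrow> nat"
  assume eq: "\<And>k. k \<in> {1..S} \<times> {1..m} \<Longrightarrow> a k = a' k"
  have "snap s a = snap s a'" by (intro snap_cong eq) (use assms in auto)
  then show "h (snap s a) = h (snap s a')" by simp
qed

lemma integrable_iter:
  fixes h :: "'a \<times> 'a \<Rightarrow> real"
  assumes "s < S" "t \<le> m"
  shows "integrable M (\<lambda>w. h (iter s t (\<lambda>k. draw k w)))"
proof (rule integrable_path)
  fix a a' :: "nat \<times> nat \<Rightarrow> nat"
  assume eq: "\<And>k. k \<in> {1..S} \<times> {1..m} \<Longrightarrow> a k = a' k"
  have "iter s t a = iter s t a'" by (intro iter_cong eq) (use assms in \<open>auto simp: past_def\<close>)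
  then show "h (iter s t a) = h (iter s t a')" by simp
qed

section \<open>Expected decrease per iteration, per epoch and overall\<close>

text \<open>Average out the next index first; the resulting p-weighted sum is bounded by
  \<open>asvrg_step\<close> with u = \<open>xstar\<close> separately for each path.\<close>

lemma expected_step:
  assumes s: "s < S" and t: "t < m"
  shows "expectation (\<lambda>w. objective (fst (iter s (Suc t) (\<lambda>k. draw k w))))
      + \<omega>\<^sup>2 / (2 * \<eta>) * expectation (\<lambda>w. (norm (xstar - snd (iter s (Suc t) (\<lambda>k. draw k w))))\<^sup>2)
    \<le> (1 - \<omega>) * expectation (\<lambda>w. objective (snap s (\<lambda>k. draw k w))) + \<omega> * objective xstar
      + \<omega>\<^sup>2 / (2 * \<eta>) * expectation (\<lambda>w. (norm (xstar - snd (iter s t (\<lambda>k. draw k w))))\<^sup>2)"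
proof -
  define c where "c = \<omega>\<^sup>2 / (2 * \<eta>)"
  define P where "P = (\<lambda>w k. draw k w)"
  define y' where "y' = (\<lambda>a i. prox_step g \<eta> \<omega> (svrg_gradient n p f (snap s a) i (fst (iter s t a))) (snd (iter s t a)))"
  \<comment> \<open>Separates the past a from the fresh index i. Although a is later the whole
    random path, h reads only its coordinates in \<open>past s t\<close>.\<close>
  define h where "h = (\<lambda>a i. objective (snap s a + \<omega> *\<^sub>R (y' a i - snap s a)) + c * (norm (xstar - y' a i))\<^sup>2)"
  define k where "k = (Suc s, Suc t)"
  have k: "k \<in> {1..S} \<times> {1..m} - past s t" using s t by (auto simp: k_def past_def)
  have J: "past s t \<subseteq> {1..S} \<times> {1..m}" using s t by (auto simp: past_def)
  have snd_Suc: "snd (iter s (Suc t) a) = y' a (a k)" for a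
    unfolding iter_def snd_asvrg_epoch_Suc y'_def k_def ..
  have fst_iter: "fst (iter s r a) = snap s a + \<omega> *\<^sub>R (snd (iter s r a) - snap s a)" for r a
    unfolding iter_def by (rule fst_asvrg_epoch)
  have h_dep: "h a b = h a' b" if "\<And>j. j \<in> past s t \<Longrightarrow> a j = a' j" for a a' b
  proof -
    have "iter s t a = iter s t a'" by (rule iter_cong[OF that])
    moreover have "snap s a = snap s a'" by (rule snap_cong, rule that) (auto simp: past_def)
    ultimately show ?thesis by (simp add: h_def y'_def)
  qed
  have int_h: "integrable M (\<lambda>w. h (P w) b)" for b
    unfolding P_def by (rule integrable_path) (rule h_dep, use J in blast)
  have "expectation (\<lambda>w. objective (fst (iter s (Suc t) (P w))))
      + c * expectation (\<lambda>w. (norm (xstar - snd (iter s (Suc t) (P w))))\<^sup>2)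
      = expectation (\<lambda>w. objective (fst (iter s (Suc t) (P w))) + c * (norm (xstar - snd (iter s (Suc t) (P w))))\<^sup>2)"
    using integrable_iter[of s "Suc t" "\<lambda>q. objective (fst q)"] integrable_iter[of s "Suc t" "\<lambda>q. (norm (xstar - snd q))\<^sup>2"] s t
    by (simp add: P_def)
  also have "\<dots> = expectation (\<lambda>w. h (P w) (draw k w))"
    unfolding h_def fst_iter[of "Suc t"] snd_Suc by (simp add: P_def)
  also have "\<dots> = expectation (\<lambda>w. \<Sum>i=1..n. p i * h (P w) i)"
    unfolding P_def by (rule expectation_indep_draw[OF draw_indep _ _ J k])
      (use k in \<open>auto intro!: draw_prob h_dep\<close>)
  also have "\<dots> \<le> expectation (\<lambda>w. (1 - \<omega>) * objective (snap s (P w)) + \<omega> * objective xstar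
      + c * (norm (xstar - snd (iter s t (P w))))\<^sup>2)"
  proof (rule integral_mono)
    show "integrable M (\<lambda>w. \<Sum>i=1..n. p i * h (P w) i)"
      by (intro Bochner_Integration.integrable_sum integrable_mult_right int_h)
    show "integrable M (\<lambda>w. (1 - \<omega>) * objective (snap s (P w)) + \<omega> * objective xstar
        + c * (norm (xstar - snd (iter s t (P w))))\<^sup>2)"
      unfolding P_def using s t
      by (intro Bochner_Integration.integrable_add integrable_mult_right integrable_const
          integrable_snap integrable_iter[where h = "\<lambda>q. (norm (xstar - snd q))\<^sup>2"]) auto
    fix w
    show "(\<Sum>i=1..n. p i * h (P w) i) \<le> (1 - \<omega>) * objective (snap s (P w)) + \<omega> * objective xstar
        + c * (norm (xstar - snd (iter s t (P w))))\<^sup>2"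
      using asvrg_step[OF g_convex eta omega fst_iter[of t "P w"], of xstar]
      by (simp add: h_def objective_def c_def y'_def)
  qed
  also have "\<dots> = (1 - \<omega>) * expectation (\<lambda>w. objective (snap s (P w))) + \<omega> * objective xstar
      + c * expectation (\<lambda>w. (norm (xstar - snd (iter s t (P w))))\<^sup>2)"
    using integrable_snap[of s objective] integrable_iter[of s t "\<lambda>q. (norm (xstar - snd q))\<^sup>2"] s t
    by (simp add: P_def prob_space)
  finally show ?thesis by (simp add: P_def c_def)
qed

lemma expected_epoch:
  assumes s: "s < S"
  shows "expectation (\<lambda>w. objective (snap (Suc s) (\<lambda>k. draw k w)) - objective xstar)
    \<le> (1 - \<omega> + \<omega>\<^sup>2 / (real m * \<mu> * \<eta>)) * expectation (\<lambda>w. objective (snap s (\<lambda>k. draw k w)) - objective xstar)"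
proof -
  define P where "P = (\<lambda>w k. draw k w)"
  define c where "c = \<omega>\<^sup>2 / (2 * \<eta>)"
  define A where "A = (\<lambda>t. expectation (\<lambda>w. objective (fst (iter s t (P w)))))"
  define D where "D = (\<lambda>t. expectation (\<lambda>w. (norm (xstar - snd (iter s t (P w))))\<^sup>2))"
  define B where "B = expectation (\<lambda>w. objective (snap s (P w)))"
  have c: "0 \<le> c" using eta(1) by (simp add: c_def)
  have tele: "(\<Sum>t=1..r. A t) + c * D r \<le> real r * ((1 - \<omega>) * B + \<omega> * objective xstar) + c * D 0" if "r \<le> m" for r
    using that
  proof (induction r)
    case (Suc r)
    have "A (Suc r) + c * D (Suc r) \<le> (1 - \<omega>) * B + \<omega> * objective xstar + c * D r"
      using expected_step[OF s, of r] Suc.prems by (simp add: A_def D_def B_def P_def c_def)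
    with Suc show ?case by (simp add: algebra_simps)
  qed simp
  \<comment> \<open>The last distance of the telescoped sum is dropped.\<close>
  have "D m \<ge> 0" unfolding D_def by (intro integral_nonneg_AE) auto
  with c have cD: "0 \<le> c * D m" by simp
  have int_F: "integrable M (\<lambda>w. objective (snap s (P w)))"
    unfolding P_def using s by (intro integrable_snap) auto
  have int_FA: "integrable M (\<lambda>w. objective (fst (iter s t (P w))))" if "t \<in> {1..m}" for t
    unfolding P_def using s that by (intro integrable_iter[where h = "\<lambda>q. objective (fst q)"]) auto
  have B': "expectation (\<lambda>w. objective (snap s (P w)) - objective xstar) = B - objective xstar"
    using int_F by (simp add: B_def prob_space)
  \<comment> \<open>Each epoch restarts y at the snapshot, so growth of the objective bounds the
    initial distance.\<close>
  have "D 0 \<le> expectation (\<lambda>w. 2 / \<mu> * (objective (snap s (P w)) - objective xstar))"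
    unfolding D_def
  proof (rule integral_mono)
    show "integrable M (\<lambda>w. (norm (xstar - snd (iter s 0 (P w))))\<^sup>2)"
      unfolding P_def using s by (intro integrable_iter[where h = "\<lambda>q. (norm (xstar - snd q))\<^sup>2"]) auto
    show "integrable M (\<lambda>w. 2 / \<mu> * (objective (snap s (P w)) - objective xstar))"
      by (intro integrable_mult_right Bochner_Integration.integrable_diff int_F integrable_const)
    fix w
    show "(norm (xstar - snd (iter s 0 (P w))))\<^sup>2 \<le> 2 / \<mu> * (objective (snap s (P w)) - objective xstar)"
      using objective_growth[of "snap s (P w)"] mu_pos
      by (simp add: iter_def norm_minus_commute[of xstar] field_simps)
  qed
  also have "\<dots> = 2 / \<mu> * (B - objective xstar)" by (simp only: integral_mult_right_zero B')
  finally have D0: "c * D 0 \<le> c * (2 / \<mu> * (B - objective xstar))" using c by (rule mult_left_mono)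
  \<comment> \<open>Jensen's inequality: the new snapshot is the uniform average of the
    x-iterates.\<close>
  have "expectation (\<lambda>w. objective (snap (Suc s) (P w)) - objective xstar)
      \<le> expectation (\<lambda>w. (\<Sum>t=1..m. (1 / real m) * objective (fst (iter s t (P w)))) - objective xstar)"
  proof (rule integral_mono)
    show "integrable M (\<lambda>w. objective (snap (Suc s) (P w)) - objective xstar)"
      unfolding P_def using s
      by (intro Bochner_Integration.integrable_diff integrable_snap integrable_const) auto
    show "integrable M (\<lambda>w. (\<Sum>t=1..m. (1 / real m) * objective (fst (iter s t (P w)))) - objective xstar)"
      by (intro Bochner_Integration.integrable_diff Bochner_Integration.integrable_sum
          integrable_mult_right int_FA integrable_const)
    fix w
    have "snap (Suc s) (P w) = (\<Sum>t=1..m. (1 / real m) *\<^sub>R fst (iter s t (P w)))"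
      by (simp add: snap_def iter_def scaleR_sum_right)
    moreover have "objective (\<Sum>t=1..m. (1 / real m) *\<^sub>R fst (iter s t (P w)))
        \<le> (\<Sum>t=1..m. (1 / real m) * objective (fst (iter s t (P w))))"
      using m_pos by (intro convex_on_sum[OF _ _ objective_convex]) auto
    ultimately show "objective (snap (Suc s) (P w)) - objective xstar
        \<le> (\<Sum>t=1..m. (1 / real m) * objective (fst (iter s t (P w)))) - objective xstar" by simp
  qed
  also have "\<dots> = expectation (\<lambda>w. \<Sum>t=1..m. (1 / real m) * objective (fst (iter s t (P w)))) - objective xstar"
  proof -
    have "integrable M (\<lambda>w. \<Sum>t=1..m. (1 / real m) * objective (fst (iter s t (P w))))"
      by (intro Bochner_Integration.integrable_sum integrable_mult_right int_FA)
    from Bochner_Integration.integral_diff[OF this integrable_const[of "objective xstar"]]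
    show ?thesis by (simp only: lebesgue_integral_const prob_space) simp
  qed
  also have "expectation (\<lambda>w. \<Sum>t=1..m. (1 / real m) * objective (fst (iter s t (P w)))) = (1 / real m) * (\<Sum>t=1..m. A t)"
  proof -
    have "expectation (\<lambda>w. \<Sum>t=1..m. (1 / real m) * objective (fst (iter s t (P w))))
        = (\<Sum>t=1..m. expectation (\<lambda>w. (1 / real m) * objective (fst (iter s t (P w)))))"
      by (intro Bochner_Integration.integral_sum integrable_mult_right int_FA)
    then show ?thesis by (simp only: integral_mult_right_zero A_def sum_distrib_left)
  qed
  also have "(1 / real m) * (\<Sum>t=1..m. A t) \<le> (1 / real m) * (real m * ((1 - \<omega>) * B + \<omega> * objective xstar) + c * (2 / \<mu> * (B - objective xstar)))"
    using tele[of m] cD D0 by (intro mult_left_mono) auto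
  also have "\<dots> - objective xstar = (1 - \<omega> + \<omega>\<^sup>2 / (real m * \<mu> * \<eta>)) * (B - objective xstar)"
  proof -
    have "(1 / real m) * (real m * ((1 - \<omega>) * B + \<omega> * objective xstar) + c * (2 / \<mu> * (B - objective xstar)))
        = (1 - \<omega>) * B + \<omega> * objective xstar + c * 2 / (real m * \<mu>) * (B - objective xstar)"
      using m_pos by (simp add: distrib_left mult.assoc)
    \<comment> \<open>Here the second part of \<rho> appears: the distance weight c times 2/\<mu>
      from growth, divided by m from averaging.\<close>
    moreover have "c * 2 / (real m * \<mu>) = \<omega>\<^sup>2 / (real m * \<mu> * \<eta>)" by (simp add: c_def mult_ac)
    ultimately show ?thesis by (simp only:) (simp add: algebra_simps)
  qed
  finally show ?thesis using B' by (simp add: P_def)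
qed

lemma expected_snapshot_gap:
  assumes "s \<le> S"
  shows "expectation (\<lambda>w. objective (snap s (\<lambda>k. draw k w)) - objective xstar)
    \<le> (1 - \<omega> + \<omega>\<^sup>2 / (real m * \<mu> * \<eta>)) ^ s * (objective x0 - objective xstar)"
  using assms
proof (induction s)
  case 0
  then show ?case by (simp add: snap_def prob_space)
next
  case (Suc s)
  define \<rho> where "\<rho> = 1 - \<omega> + \<omega>\<^sup>2 / (real m * \<mu> * \<eta>)"
  \<comment> \<open>These give \<omega> \<le> 1, hence \<rho> \<ge> 0, without which the induction
    hypothesis could not be multiplied by \<rho>.\<close>
  have "0 < L_tilde n p L * \<eta>" "L_tilde n p L * \<eta> < 1"
    using eta L_tilde_pos by (auto simp: field_simps)
  then have "0 \<le> L_tilde n p L * \<eta> / (1 - L_tilde n p L * \<eta>)" by simp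
  with omega(2) have "0 \<le> 1 - \<omega>" by linarith
  then have \<rho>: "0 \<le> \<rho>" using mu_pos eta(1) by (simp add: \<rho>_def)
  have "expectation (\<lambda>w. objective (snap (Suc s) (\<lambda>k. draw k w)) - objective xstar)
      \<le> \<rho> * expectation (\<lambda>w. objective (snap s (\<lambda>k. draw k w)) - objective xstar)"
    unfolding \<rho>_def using Suc.prems by (intro expected_epoch) simp
  also have "\<dots> \<le> \<rho> * (\<rho> ^ s * (objective x0 - objective xstar))"
    using Suc \<rho> by (intro mult_left_mono) (auto simp: \<rho>_def)
  finally show ?case by (simp add: \<rho>_def mult.assoc)
qed

end

theorem theorem3:
  fixes f :: "nat \<Rightarrow> real ^ 'd \<Rightarrow> real"
    and g F :: "real ^ 'd \<Rightarrow> real"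
    and L p :: "nat \<Rightarrow> real"
    and n m S :: nat
    and \<mu> \<eta> \<omega> \<rho> :: real
    and x0 xstar :: "real ^ 'd"
    and M :: "'w measure"
    and idx :: "nat \<Rightarrow> nat \<Rightarrow> 'w \<Rightarrow> nat"
  assumes f_convex: "\<And>i. i \<in> {1..n} \<Longrightarrow> convex_on UNIV (f i)"
    and L_pos: "\<And>i. i \<in> {1..n} \<Longrightarrow> L i > 0"
    and f_smooth: "\<And>i. i \<in> {1..n} \<Longrightarrow> L_smooth (L i) (f i)"
    and mu_pos: "\<mu> > 0"
    and g_strongly_convex: "strongly_convex \<mu> g"
    and F_def: "F = (\<lambda>x. average n f x + g x)"
    and xstar_min: "\<And>x. F xstar \<le> F x"
    and p_pos: "\<And>i. i \<in> {1..n} \<Longrightarrow> p i > 0"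
    and p_sum: "(\<Sum>i=1..n. p i) = 1"
    and eta: "0 < \<eta>" "\<eta> < 1 / L_tilde n p L"
    and omega: "0 < \<omega>" "\<omega> \<le> 1 - L_tilde n p L * \<eta> / (1 - L_tilde n p L * \<eta>)"
    and m_pos: "m \<ge> 1"
    and rho_def: "\<rho> = 1 - \<omega> + \<omega>\<^sup>2 / (real m * \<mu> * \<eta>)"
    and rho_less: "\<rho> < 1"
    and prob: "prob_space M"
    and idx: "iid_indices M n p S m idx"
  shows "\<forall>s\<in>{1..S}.
    prob_space.expectation M
      (\<lambda>w. F (asvrg_snapshot n p f g \<eta> \<omega> m x0 (\<lambda>s t. idx s t w) s) - F xstar)
    \<le> \<rho> ^ s * (F x0 - F xstar)"
proof
  fix s assume "s \<in> {1..S}"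
  have min: "\<And>x. average n f xstar + g xstar \<le> average n f x + g x"
    using xstar_min by (simp add: F_def)
  interpret asvrg f L p n M g m S \<mu> \<eta> \<omega> x0 xstar idx
    by (intro asvrg.intro svrg_setting.intro asvrg_axioms.intro) (fact min prob mu_pos g_strongly_convex p_sum eta omega m_pos idx
        | erule f_convex L_pos f_smooth p_pos)+
  have "F = objective" by (simp add: fun_eq_iff F_def objective_def)
  then show "expectation (\<lambda>w. F (asvrg_snapshot n p f g \<eta> \<omega> m x0 (\<lambda>s t. idx s t w) s) - F xstar)
    \<le> \<rho> ^ s * (F x0 - F xstar)"
    using expected_snapshot_gap[of s] \<open>s \<in> {1..S}\<close>
    by (simp add: snap_def draw_def rho_def)
qed

end
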